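(* Let $n\in\{0,1,2,\ldots\}$ and let $\omega\in\mathbb{R}\setminus\{0,-1,-2,\ldots,-(n+1)\}$. Then the following identities between polynomials in $z$ hold: the lifting recurrence $$\frac{(2+\omega)_n}{n!}\,\mathcal{S}_n^{\omega+1}(z)=(1+z)\sum_{\ell=0}^{n-1}\frac{(1+\omega)_\ell}{\ell!}\,z^{n-\ell-1}\,\mathcal{S}_\ell^\omega(z)+\frac{(1+\omega)_n}{n!}\,\mathcal{S}_n^\omega(z)$$ and the lowering recurrence $$\frac{(\omega)_n}{n!}\,\mathcal{S}_n^{\omega-1}(z)=(1+z)\sum_{\ell=0}^{n-1}(-1)^{n-\ell}\,\frac{(1+\omega)_\ell}{\ell!}\,\mathcal{S}_\ell^\omega(z)+\frac{(1+\omega)_n}{n!}\,\mathcal{S}_n^\omega(z).$$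
   Context: For $n\in\{0,1,2,\ldots\}$ and real $\omega\notin\{-1,\ldots,-n\}$ the skyburst polynomial $\mathcal{S}_n^\omega$ is the monic polynomial of degree $n$ $$\mathcal{S}_n^\omega(z)=z^n\,{}_2F_1\!\left[\begin{array}{l}-n,-\omega;\\-n-\omega;\end{array}-\frac1z\right]=\sum_{\ell=0}^n\binom{n}{\ell}\frac{(-\omega)_\ell}{(-n-\omega)_\ell}\,z^{n-\ell},$$ where $(a)_\ell=a(a+1)\cdots(a+\ell-1)$, $(a)_0=1$. Empty sums are zero. *)

theory Defs
  imports Complex_Main "HOL-Computational_Algebra.Polynomial"
begin

text \<open>
  Meaningful for \<open>\<omega> \<notin> {-1, \<dots>, -n}\<close>; for excluded parameters some denominators
  vanish and the corresponding coefficients default to zero.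
\<close>

definition skyburst :: "nat \<Rightarrow> real \<Rightarrow> real poly" where
  "skyburst n \<omega> =
     (\<Sum>l=0..n. monom (of_nat (n choose l) * (pochhammer (- \<omega>) l / pochhammer (- real n - \<omega>) l)) (n - l))"

lemma degree_skyburst: "degree (skyburst n \<omega>) = n"
  and lead_coeff_skyburst: "lead_coeff (skyburst n \<omega>) = 1"
proof -
  have c: "coeff (skyburst n \<omega>) n = 1"
  proof -
    have "coeff (skyburst n \<omega>) n =
      (\<Sum>l=0..n. if l = 0 then 1 else 0)"
      unfolding skyburst_def coeff_sum by (intro sum.cong) auto
    then show ?thesis by simp
  qed
  have "degree (skyburst n \<omega>) \<le> n"
    unfolding skyburst_def
    by (intro degree_sum_le) (auto intro: order_trans[OF degree_monom_le])
  moreover have "n \<le> degree (skyburst n \<omega>)" using c by (intro le_degree) simp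
  ultimately show d: "degree (skyburst n \<omega>) = n" by simp
  show "lead_coeff (skyburst n \<omega>) = 1" using c d by simp
qed

text \<open>The terminating hypergeometric series \<open>z\<^sup>n \<^sub>2F\<^sub>1[-n, -\<omega>; -n-\<omega>; -1/z]\<close>.\<close>

lemma poly_skyburst_hypergeometric:
  assumes "z \<noteq> 0"
  shows "poly (skyburst n \<omega>) z = z ^ n *
    (\<Sum>l. pochhammer (- real n) l * pochhammer (- \<omega>) l / pochhammer (- real n - \<omega>) l
             * (- 1 / z) ^ l / fact l)" (is "_ = _ * (\<Sum>l. ?f l)")
proof -
  have "suminf ?f = sum ?f {0..n}"
    by (rule suminf_finite) (auto simp: pochhammer_of_nat_eq_0_lemma)
  moreover have "z ^ n * ?f l =
      of_nat (n choose l) * (pochhammer (- \<omega>) l / pochhammer (- real n - \<omega>) l) * z ^ (n - l)"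
    if "l \<in> {0..n}" for l
  proof -
    have b: "real (n choose l) = (- 1) ^ l * pochhammer (- real n) l / fact l"
      by (simp add: binomial_gbinomial gbinomial_pochhammer)
    have "z ^ n * (- 1 / z) ^ l = (- 1) ^ l * z ^ (n - l)"
      using that assms using power_mult_distrib[of "-1" "1 / z" l]
      by (simp add: power_divide power_diff)
    then show ?thesis unfolding b
      by (simp add: field_simps)
  qed
  ultimately show ?thesis
    unfolding skyburst_def by (simp add: poly_sum poly_monom sum_distrib_left)
qed

end

theory Submission
  imports Defs
begin

text \<open>
  Rescaled by \<open>(1 + \<omega>)\<^sub>n / n!\<close>, the skyburst polynomials have the generating function
  \<open>(1 + t)\<^sup>\<omega> (1 - z t)\<^sup>-\<^sup>1\<^sup>-\<^sup>\<omega>\<close>. Raising \<open>\<omega>\<close> by one multiplies it by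
  \<open>(1 + t) / (1 - z t) = 1 + (1 + z) t / (1 - z t)\<close>, and lowering \<open>\<omega>\<close> by one multiplies it by
  \<open>(1 - z t) / (1 + t) = 1 - (1 + z) t / (1 + t)\<close>; comparing coefficients of \<open>t\<^sup>n\<close> gives the two
  recurrences.
\<close>

text \<open>The \<open>t^n\<close> coefficient of the generating function, as the Cauchy product of
  its two binomial series. No denominator involves \<omega>, so the recurrences between these
  polynomials need no excluded parameters.\<close>

definition scaled_skyburst :: "nat \<Rightarrow> real \<Rightarrow> real poly" where
  "scaled_skyburst n \<omega> =
     (\<Sum>k\<le>n. monom ((\<omega> gchoose (n - k)) * (pochhammer (1 + \<omega>) k / fact k)) k)"

lemma coeff_scaled_skyburst:
  "coeff (scaled_skyburst n \<omega>) k =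
     (if k \<le> n then (\<omega> gchoose (n - k)) * (pochhammer (1 + \<omega>) k / fact k) else 0)"
  unfolding scaled_skyburst_def coeff_sum coeff_monom by simp

lemma scaled_skyburst_0: "scaled_skyburst 0 \<omega> = 1"
  by (simp add: scaled_skyburst_def)

lemma coeff_skyburst:
  "coeff (skyburst n \<omega>) k =
     (if k \<le> n then of_nat (n choose k) *
        (pochhammer (- \<omega>) (n - k) / pochhammer (- real n - \<omega>) (n - k)) else 0)"
proof -
  have "coeff (skyburst n \<omega>) k =
      (\<Sum>l=0..n. if l = n - k \<and> k \<le> n then of_nat (n choose l) *
        (pochhammer (- \<omega>) l / pochhammer (- real n - \<omega>) l) else 0)"
    unfolding skyburst_def coeff_sum coeff_monom by (intro sum.cong) auto
  then show ?thesis
    by (auto simp: binomial_symmetric[symmetric])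
qed

text \<open>Split off the first \<open>k\<close> factors; reversing the order and the signs of the
  others gives exactly the denominator of a skyburst coefficient.\<close>

lemma pochhammer_eq_mult_reflected:
  fixes \<omega> :: real
  assumes "k \<le> n"
  shows "pochhammer (1 + \<omega>) n =
    pochhammer (1 + \<omega>) k * ((- 1) ^ (n - k) * pochhammer (- real n - \<omega>) (n - k))"
proof -
  have "- real n - \<omega> = - (real n + \<omega>)"
    "real n + \<omega> - real (n - k) + 1 = 1 + \<omega> + real k"
    using assms by (simp_all add: of_nat_diff)
  then have "pochhammer (- real n - \<omega>) (n - k) =
      (- 1) ^ (n - k) * pochhammer (1 + \<omega> + real k) (n - k)"
    using pochhammer_minus[of "real n + \<omega>" "n - k"] by metis
  then show ?thesis
    using pochhammer_product[OF assms, of "1 + \<omega>"] by (simp flip: power_mult_distrib mult.assoc)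
qed

text \<open>After the denominator cancels,
  \<open>(-1)^(n-k) * pochhammer (-\<omega>) (n-k) / fact (n-k)\<close> remains beside the
  Pochhammer factor, and this is the generalized binomial coefficient.\<close>

lemma smult_skyburst:
  assumes "\<And>j. 1 \<le> j \<Longrightarrow> j \<le> n \<Longrightarrow> \<omega> \<noteq> - real j"
  shows "smult (pochhammer (1 + \<omega>) n / fact n) (skyburst n \<omega>) = scaled_skyburst n \<omega>"
proof (rule poly_eqI)
  fix k
  have "pochhammer (- real n - \<omega>) (n - k) \<noteq> 0" if "k \<le> n"
  proof
    assume "pochhammer (- real n - \<omega>) (n - k) = 0"
    then obtain i where i: "i < n - k" "- real n - \<omega> = - real i"
      by (auto simp: pochhammer_eq_0_iff)
    then have "\<omega> = - real (n - i)" by (simp add: of_nat_diff)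
    then show False using assms[of "n - i"] i by linarith
  qed
  then show "coeff (smult (pochhammer (1 + \<omega>) n / fact n) (skyburst n \<omega>)) k =
      coeff (scaled_skyburst n \<omega>) k"
    by (auto simp: coeff_skyburst coeff_scaled_skyburst pochhammer_eq_mult_reflected[of k n]
        gbinomial_pochhammer binomial_fact field_simps)
qed

text \<open>Pascal's rule for the other series: the coefficients in
  \<open>(1 - x) * (1 - x)^(-2-\<omega>) = (1 - x)^(-1-\<omega>)\<close>.\<close>

lemma pochhammer_fact_Suc:
  fixes \<omega> :: real
  shows "pochhammer (2 + \<omega>) (Suc k) / fact (Suc k) =
    pochhammer (2 + \<omega>) k / fact k + pochhammer (1 + \<omega>) (Suc k) / fact (Suc k)"
proof -
  have "pochhammer (1 + \<omega>) (Suc k) = (1 + \<omega>) * pochhammer (2 + \<omega>) k"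
    by (simp add: pochhammer_rec algebra_simps)
  moreover have "pochhammer (2 + \<omega>) (Suc k) = (2 + \<omega> + real k) * pochhammer (2 + \<omega>) k"
    by (simp add: pochhammer_Suc)
  ultimately show ?thesis
    by (simp add: fact_Suc divide_simps) (simp add: algebra_simps)
qed

text \<open>Write G(\<omega>) for the generating function. This is the coefficient of
  \<open>t^(n+1)\<close> in \<open>(1 - z t) G(\<omega>+1) = (1 + t) G(\<omega>)\<close>, with
  \<open>pCons 0\<close> as multiplication by z. Both recurrences come from it.\<close>

lemma scaled_skyburst_Suc:
  "scaled_skyburst (Suc n) (\<omega> + 1) - pCons 0 (scaled_skyburst n (\<omega> + 1)) =
     scaled_skyburst (Suc n) \<omega> + scaled_skyburst n \<omega>"
proof (rule poly_eqI)
  fix k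
  show "coeff (scaled_skyburst (Suc n) (\<omega> + 1) - pCons 0 (scaled_skyburst n (\<omega> + 1))) k =
      coeff (scaled_skyburst (Suc n) \<omega> + scaled_skyburst n \<omega>) k"
  proof (cases k)
    case 0
    then show ?thesis
      by (simp add: coeff_scaled_skyburst gbinomial_Suc_Suc)
  next
    case (Suc j)
    have p: "1 + (\<omega> + 1) = 2 + \<omega>" by simp
    have "coeff (scaled_skyburst (Suc n) (\<omega> + 1) - pCons 0 (scaled_skyburst n (\<omega> + 1))) k =
        (if j \<le> n then (\<omega> + 1 gchoose (n - j)) * (pochhammer (1 + \<omega>) (Suc j) / fact (Suc j)) else 0)"
      unfolding Suc coeff_diff coeff_pCons_Suc coeff_scaled_skyburst p pochhammer_fact_Suc
      by (simp add: algebra_simps)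
    \<comment> \<open>At \<open>j = n\<close> the truncated \<open>n - Suc j\<close> would yield a
      spurious 1; there \<open>scaled_skyburst n \<omega>\<close> contributes nothing, and that case
      is treated separately.\<close>
    moreover have "\<omega> + 1 gchoose (n - j) = (\<omega> gchoose (n - j)) + (\<omega> gchoose (n - Suc j))"
      if "j < n"
      using that gbinomial_Suc_Suc[of \<omega> "n - Suc j"] by (simp add: Suc_diff_Suc)
    ultimately show ?thesis
      unfolding Suc coeff_add coeff_scaled_skyburst
      by (cases "j < n"; cases "j = n") (auto simp add: distrib_right add_divide_distrib simp del: fact_Suc)
  qed
qed

text \<open>Solves the preceding relation as a first-order recurrence in \<open>n\<close> for
  parameter \<omega>+1; the sum builds up by Horner's scheme in z.\<close>

lemma scaled_skyburst_lift:
  "scaled_skyburst n (\<omega> + 1) =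
     [:1, 1:] * (\<Sum>l<n. monom 1 (n - l - 1) * scaled_skyburst l \<omega>) + scaled_skyburst n \<omega>"
proof (induction n)
  case 0
  then show ?case by (simp add: scaled_skyburst_0)
next
  case (Suc n)
  let ?T = "\<lambda>n. \<Sum>l<n. monom 1 (n - l - 1) * scaled_skyburst l \<omega>"
  have "monom 1 (n - l) * p = pCons 0 (monom 1 (n - l - 1) * p)" if "l < n"
    for l and p :: "real poly"
  proof -
    have "n - l = Suc (n - l - 1)" using that by simp
    then show ?thesis by (metis monom_Suc mult_pCons_left smult_0_left add_0)
  qed
  then have T: "?T (Suc n) = [:0, 1:] * ?T n + scaled_skyburst n \<omega>"
    by (simp add: sum_distrib_left)
  have "scaled_skyburst (Suc n) (\<omega> + 1) =
      [:0, 1:] * scaled_skyburst n (\<omega> + 1) + scaled_skyburst (Suc n) \<omega> + scaled_skyburst n \<omega>"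
    using scaled_skyburst_Suc[of n \<omega>] by (simp add: algebra_simps)
  moreover have "[:1, 1:] = 1 + [:0, 1::real:]" by (simp add: one_pCons)
  ultimately show ?case
    unfolding T Suc.IH by algebra
qed

text \<open>The same relation at \<omega>-1, now solved for the polynomials of the smaller
  parameter: each step multiplies by -1 instead of z, whence the alternating signs.\<close>

lemma scaled_skyburst_lower:
  "scaled_skyburst n (\<omega> - 1) =
     [:1, 1:] * (\<Sum>l<n. smult ((- 1) ^ (n - l)) (scaled_skyburst l \<omega>)) + scaled_skyburst n \<omega>"
proof (induction n)
  case 0
  then show ?case by (simp add: scaled_skyburst_0)
next
  case (Suc n)
  let ?U = "\<lambda>n. \<Sum>l<n. smult ((- 1) ^ (n - l)) (scaled_skyburst l \<omega>)"
  have U: "?U (Suc n) = - ?U n - scaled_skyburst n \<omega>"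
    by (simp add: Suc_diff_le sum_negf)
  have "scaled_skyburst (Suc n) (\<omega> - 1) =
      scaled_skyburst (Suc n) \<omega> - [:0, 1:] * scaled_skyburst n \<omega> - scaled_skyburst n (\<omega> - 1)"
    using scaled_skyburst_Suc[of n "\<omega> - 1"] by (simp add: algebra_simps)
  moreover have "[:1, 1:] = 1 + [:0, 1::real:]" by (simp add: one_pCons)
  ultimately show ?case
    unfolding U Suc.IH by algebra
qed

theorem theorem3:
  fixes n :: nat and \<omega> :: real
  assumes "\<omega> \<notin> {- real k | k. k \<le> n + 1}"
  shows "smult (pochhammer (2 + \<omega>) n / fact n) (skyburst n (\<omega> + 1)) =
           [:1, 1:] * (\<Sum>l<n. smult (pochhammer (1 + \<omega>) l / fact l)
                                (monom 1 (n - l - 1) * skyburst l \<omega>))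
           + smult (pochhammer (1 + \<omega>) n / fact n) (skyburst n \<omega>)
         \<and> smult (pochhammer \<omega> n / fact n) (skyburst n (\<omega> - 1)) =
           [:1, 1:] * (\<Sum>l<n. smult ((- 1) ^ (n - l) * (pochhammer (1 + \<omega>) l / fact l))
                                (skyburst l \<omega>))
           + smult (pochhammer (1 + \<omega>) n / fact n) (skyburst n \<omega>)"
proof -
  have \<omega>: "\<omega> \<noteq> - real k" if "k \<le> n + 1" for k
    using assms that by blast
  have P: "smult (pochhammer (1 + \<omega>) l / fact l) (skyburst l \<omega>) = scaled_skyburst l \<omega>"
    if "l \<le> n" for l
    using that \<omega> by (intro smult_skyburst) simp
  have "smult (pochhammer (1 + (\<omega> + 1)) n / fact n) (skyburst n (\<omega> + 1)) =
      scaled_skyburst n (\<omega> + 1)"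
  proof (rule smult_skyburst)
    \<comment> \<open>The case \<open>j = n\<close> is why -(n+1) must be excluded.\<close>
    show "\<omega> + 1 \<noteq> - real j" if "j \<le> n" for j
      using \<omega>[of "j + 1"] that by auto
  qed
  then have lift: "smult (pochhammer (2 + \<omega>) n / fact n) (skyburst n (\<omega> + 1)) =
      scaled_skyburst n (\<omega> + 1)"
    by (simp add: algebra_simps)
  have "smult (pochhammer (1 + (\<omega> - 1)) n / fact n) (skyburst n (\<omega> - 1)) =
      scaled_skyburst n (\<omega> - 1)"
  proof (rule smult_skyburst)
    \<comment> \<open>The case \<open>j = 1\<close> is why 0 must be excluded.\<close>
    show "\<omega> - 1 \<noteq> - real j" if "1 \<le> j" "j \<le> n" for j
      using \<omega>[of "j - 1"] that by (simp add: of_nat_diff) linarith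
  qed
  then have lower: "smult (pochhammer \<omega> n / fact n) (skyburst n (\<omega> - 1)) =
      scaled_skyburst n (\<omega> - 1)"
    by simp
  have "(\<Sum>l<n. smult (pochhammer (1 + \<omega>) l / fact l) (monom 1 (n - l - 1) * skyburst l \<omega>)) =
      (\<Sum>l<n. monom 1 (n - l - 1) * scaled_skyburst l \<omega>)"
    by (intro sum.cong refl) (simp flip: P)
  moreover have "(\<Sum>l<n. smult ((- 1) ^ (n - l) * (pochhammer (1 + \<omega>) l / fact l)) (skyburst l \<omega>)) =
      (\<Sum>l<n. smult ((- 1) ^ (n - l)) (scaled_skyburst l \<omega>))"
    by (intro sum.cong refl) (simp flip: P)
  ultimately show ?thesis
    unfolding lift lower P[OF order_refl]
    using scaled_skyburst_lift[of n \<omega>] scaled_skyburst_lower[of n \<omega>] by simp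
qed

end
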